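(* Let $n\ge 1$, let $\mathcal{C}\subseteq\{1,\dots,n\}$ be nonempty, and let $\beta>0$ and $r\in\mathbb{R}$. Let $\boldsymbol{f},\boldsymbol{p}\in\mathbb{R}^n$ satisfy $\boldsymbol{f}_i\ge 0$ and $0\le\boldsymbol{p}_i\le r$ for all $i$, and $\boldsymbol{f}_i=0$ for all $i\notin\mathcal{C}$. Consider the optimization problem over $\boldsymbol{x}\in\mathbb{R}^n$ $$\begin{aligned}\text{minimize}\quad&\tfrac12\Vert r\boldsymbol{x}-\boldsymbol{p}\circ\boldsymbol{f}\Vert_2^2+\beta\Vert\boldsymbol{x}-\boldsymbol{f}\Vert_2^2\\ \text{subject to}\quad&\boldsymbol{x}_i\ge 0\ \ (i\in\mathcal{C}),\qquad \boldsymbol{x}_i=0\ \ (i\notin\mathcal{C}),\qquad \Vert\boldsymbol{x}\Vert_1=\Vert\boldsymbol{f}\Vert_1.\end{aligned}$$ Then the optimal solution $\widetilde{\boldsymbol{x}}$ is given by $$\widetilde{\boldsymbol{x}}_i=\frac{r\boldsymbol{p}_i+2\beta}{r^2+2\beta}\,\boldsymbol{f}_i+\frac{r\sum_{j\in\mathcal{C}}(r\boldsymbol{f}_j-\boldsymbol{p}_j\boldsymbol{f}_j)}{|\mathcal{C}|\,(r^2+2\beta)},\qquad i\in\mathcal{C},$$ and $\widetilde{\boldsymbol{x}}_i=0$ for $i\notin\mathcal{C}$.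
   Context: $\circ$ denotes the entrywise (Hadamard) product of vectors, $\Vert\cdot\Vert_1$ and $\Vert\cdot\Vert_2$ are the usual $\ell_1$ and $\ell_2$ norms on $\mathbb{R}^n$, and $|\mathcal{C}|$ is the cardinality of $\mathcal{C}$. *)

theory Defs
  imports "HOL-Analysis.Analysis"
begin

(* Vectors in R^n are elements of real ^ 'n, with the index type 'n in the role of {1,...,n}.
   On this type the library's "*" is the entrywise (Hadamard) product and "norm" is the l2 norm. *)

definition l1_norm :: "real ^ 'n \<Rightarrow> real" where
  "l1_norm x = (\<Sum>i\<in>UNIV. \<bar>x $ i\<bar>)"

definition objective :: "real \<Rightarrow> real \<Rightarrow> real ^ 'n \<Rightarrow> real ^ 'n \<Rightarrow> real ^ 'n \<Rightarrow> real" where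
  "objective \<beta> r p f x = 1 / 2 * (norm (r *\<^sub>R x - p * f))\<^sup>2 + \<beta> * (norm (x - f))\<^sup>2"

definition feasible :: "'n set \<Rightarrow> real ^ 'n \<Rightarrow> real ^ 'n \<Rightarrow> bool" where
  "feasible C f x \<longleftrightarrow>
     (\<forall>i\<in>C. x $ i \<ge> 0) \<and> (\<forall>i. i \<notin> C \<longrightarrow> x $ i = 0) \<and> l1_norm x = l1_norm f"

end

(* Expanding the quadratic objective around the claimed minimiser y leaves the positive term
   (r^2/2 + beta) |x - y|^2 and a linear term. The i-th partial derivative at y has the same value
   for every i in C, so the linear term is a multiple of the sum of the x_i - y_i, which vanishes
   because feasible points are nonnegative and have the same l1 norm. *)
theory Submission
  imports Defs
begin

lemma norm_squared_eq_sum: "(norm (x :: real ^ 'n::finite))\<^sup>2 = (\<Sum>i\<in>UNIV. (x $ i)\<^sup>2)"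
  by (simp add: power2_norm_eq_inner inner_vec_def flip: power2_eq_square)

text \<open>This is the exact second-order Taylor expansion at \<open>y\<close>: the Hessian is
  \<open>r\<^sup>2 + 2 * \<beta>\<close> times the identity, and the last factor in the sum is the
  partial derivative \<open>r * (r * y $ i - p $ i * f $ i) + 2 * \<beta> * (y $ i - f $ i)\<close>,
  regrouped.\<close>

lemma objective_expand:
  fixes f p x y :: "real ^ 'n::finite"
  shows "objective \<beta> r p f x = objective \<beta> r p f y + (r\<^sup>2 / 2 + \<beta>) * (norm (x - y))\<^sup>2
    + (\<Sum>i\<in>UNIV. (x $ i - y $ i) * ((r\<^sup>2 + 2 * \<beta>) * y $ i - (r * p $ i + 2 * \<beta>) * f $ i))"
  unfolding objective_def norm_squared_eq_sum sum_distrib_left sum.distrib [symmetric]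
  by (rule sum.cong) (simp_all add: power2_eq_square field_simps)

lemma feasible_imp_sum_eq:
  fixes f x :: "real ^ 'n::finite"
  assumes "feasible C f x"
  shows "(\<Sum>i\<in>C. x $ i) = l1_norm f"
proof -
  have "l1_norm f = (\<Sum>i\<in>UNIV. \<bar>x $ i\<bar>)"
    using assms by (simp add: feasible_def l1_norm_def)
  also have "\<dots> = (\<Sum>i\<in>C. x $ i)"
    using assms by (intro sum.mono_neutral_cong_right) (auto simp: feasible_def)
  finally show ?thesis by simp
qed

text \<open>Stationarity in Lagrange form, with \<open>c\<close> the multiplier of the norm
  constraint. Strict convexity makes it sufficient and also yields uniqueness, hence the
  equivalence.\<close>

lemma is_arg_min_objective_iff:
  fixes f p x y :: "real ^ 'n::finite"
  assumes "\<beta> > 0" and y: "feasible C f y"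
    and stat: "\<And>i. i \<in> C \<Longrightarrow> (r\<^sup>2 + 2 * \<beta>) * y $ i - (r * p $ i + 2 * \<beta>) * f $ i = c"
  shows "is_arg_min (objective \<beta> r p f) (feasible C f) x \<longleftrightarrow> x = y"
proof -
  have pos: "r\<^sup>2 / 2 + \<beta> > 0"
    using \<open>\<beta> > 0\<close> by (simp add: add_nonneg_pos)
  have eq: "objective \<beta> r p f z = objective \<beta> r p f y + (r\<^sup>2 / 2 + \<beta>) * (norm (z - y))\<^sup>2"
    if z: "feasible C f z" for z
  proof -
    have "(\<Sum>i\<in>UNIV. (z $ i - y $ i) * ((r\<^sup>2 + 2 * \<beta>) * y $ i - (r * p $ i + 2 * \<beta>) * f $ i))
        = (\<Sum>i\<in>C. (z $ i - y $ i) * c)"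
      \<comment> \<open>Both points vanish off \<open>C\<close>, so only coordinates with derivative
        \<open>c\<close> contribute.\<close>
      using y z by (intro sum.mono_neutral_cong_right) (auto simp: feasible_def stat)
    also have "\<dots> = 0"
      using feasible_imp_sum_eq [OF y] feasible_imp_sum_eq [OF z]
      by (simp add: sum_distrib_right [symmetric] sum_subtractf)
    finally show ?thesis
      using objective_expand [of \<beta> r p f z y] by simp
  qed
  have less: "objective \<beta> r p f y < objective \<beta> r p f z" if "feasible C f z" "z \<noteq> y" for z
    using eq [OF that(1)] pos that(2) by simp
  show ?thesis
    unfolding is_arg_min_def using y less by (metis less_asym)
qed

theorem mainTheorem3:
  fixes C :: "'n::finite set" and \<beta> r :: real and f p :: "real ^ 'n"
  assumes "C \<noteq> {}"
    and "\<beta> > 0"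
    and "\<forall>i. f $ i \<ge> 0"
    and "\<forall>i. 0 \<le> p $ i \<and> p $ i \<le> r"
    and "\<forall>i. i \<notin> C \<longrightarrow> f $ i = 0"
  shows "{x. is_arg_min (objective \<beta> r p f) (feasible C f) x} =
    {\<chi> i. if i \<in> C
          then (r * p $ i + 2 * \<beta>) / (r\<^sup>2 + 2 * \<beta>) * f $ i
               + (r * (\<Sum>j\<in>C. r * f $ j - p $ j * f $ j)) / (real (card C) * (r\<^sup>2 + 2 * \<beta>))
          else 0}"
    (is "_ = {?y}")
proof -
  define K where "K = r\<^sup>2 + 2 * \<beta>"
  define S where "S = (\<Sum>j\<in>C. r * f $ j - p $ j * f $ j)"
  have K: "K > 0"
    using assms(2) by (simp add: K_def add_nonneg_pos)
  \<comment> \<open>The bounds on \<open>p\<close> at any index give this. Together with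
    \<open>S \<ge> 0\<close> it makes the common shift in \<open>?y\<close> nonnegative.\<close>
  have r: "r \<ge> 0"
    using assms(4) order_trans by blast
  have S: "S \<ge> 0"
    unfolding S_def using assms(3,4) by (intro sum_nonneg) (simp add: mult_right_mono)
  have y: "?y $ i = (r * p $ i + 2 * \<beta>) / K * f $ i + r * S / (real (card C) * K)"
    if "i \<in> C" for i
    using that by (simp add: K_def S_def)
  have y0: "?y $ i = 0" if "i \<notin> C" for i
    using that by simp
  have nonneg: "?y $ i \<ge> 0" if "i \<in> C" for i
    unfolding y [OF that] using assms(2-4) K S r by simp
  \<comment> \<open>The first summand of \<open>?y $ i\<close> cancels against the \<open>f\<close>
    term, so \<open>K\<close> times the shift remains.\<close>
  have stat: "(r\<^sup>2 + 2 * \<beta>) * ?y $ i - (r * p $ i + 2 * \<beta>) * f $ i = r * S / real (card C)"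
    if "i \<in> C" for i
    unfolding y [OF that] unfolding K_def [symmetric] using K by (simp add: field_simps)
  have "l1_norm ?y = (\<Sum>i\<in>C. ?y $ i)"
    unfolding l1_norm_def using nonneg y0 by (intro sum.mono_neutral_cong_right) auto
  also have "\<dots> = (\<Sum>i\<in>C. f $ i)"
  proof -
    have "K * (\<Sum>i\<in>C. ?y $ i) = (\<Sum>i\<in>C. (r * p $ i + 2 * \<beta>) * f $ i + r * S / real (card C))"
    proof (subst sum_distrib_left, rule sum.cong [OF refl])
      fix i
      assume "i \<in> C"
      from stat [OF this]
      show "K * ?y $ i = (r * p $ i + 2 * \<beta>) * f $ i + r * S / real (card C)"
        unfolding K_def by linarith
    qed
    also have "\<dots> = (\<Sum>i\<in>C. (r * p $ i + 2 * \<beta>) * f $ i) + r * S"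
      using assms(1) by (simp add: sum.distrib)
    \<comment> \<open>The shift restores exactly the missing mass: \<open>r * p $ i * f $ i\<close>
      and \<open>r * (r * f $ i - p $ i * f $ i)\<close> add up to
      \<open>r\<^sup>2 * f $ i\<close>.\<close>
    also have "\<dots> = (\<Sum>i\<in>C. K * f $ i)"
      unfolding S_def K_def sum_distrib_left sum.distrib [symmetric]
      by (intro sum.cong refl) (simp add: power2_eq_square algebra_simps)
    finally show ?thesis
      using K by (simp add: sum_distrib_left [symmetric])
  qed
  also have "\<dots> = l1_norm f"
    unfolding l1_norm_def using assms(3,5) by (intro sum.mono_neutral_cong_left) auto
  finally have "feasible C f ?y"
    unfolding feasible_def using nonneg y0 by blast
  then show ?thesis
    using is_arg_min_objective_iff [OF assms(2) _ stat] by blast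
qed

end
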